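(* Let $P$ and $Q$ be Borel probability measures on a Polish space $\Omega$ with $Q \ll P$, and let $K$ be the index returned by greedy rejection sampling with target $Q$ and i.i.d. proposals from $P$. Then $$\mathbb{H}[K]\le D_{CS}[Q\|P]+\log_2(e+1).$$
   Context: Greedy rejection sampling (GRS). Let $X_1,X_2,\dots$ be i.i.d. with law $P$ and let $U_1,U_2,\dots$ be i.i.d. uniform on $(0,1)$, independent of the $X_i$. Fix a version of $\frac{dQ}{dP}$. Define deterministic sequences by $L_1=0$, $S_1=1$ and, for $k\ge1$, $$L_{k+1}=L_k+S_k,\qquad \mathcal{H}_{k+1}=\left\{y\in\Omega : L_{k+1}\le \tfrac{dQ}{dP}(y)\right\},\qquad S_{k+1}=Q(\mathcal{H}_{k+1})-L_{k+1}P(\mathcal{H}_{k+1}).$$ At step $k=1,2,\dots$ set $$\beta_k=\min\left\{1,\max\left\{0,\left(\tfrac{dQ}{dP}(X_k)-L_k\right)/S_k\right\}\right\};$$ if $U_k\le\beta_k$ the algorithm stops and returns $X_k$ and the index $K=k$; otherwise it proceeds to step $k+1$. (If $S_k=0$ the algorithm has almost surely already stopped before step $k$, so the value of $\beta_k$ is then irrelevant.) For $Q\ll P$ define $w(h)=P\left(\frac{dQ}{dP}\ge h\right)$ for $h\ge 0$. The channel simulation divergence is $$D_{CS}[Q\|P]=-\int_0^\infty w(h)\log_2 w(h)\,dh\in[0,\infty],$$ with the convention $0\log_2 0=0$. $\mathbb{H}[K]=-\sum_k \mathbb{P}[K=k]\log_2\mathbb{P}[K=k]\in[0,\infty]$ is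 the Shannon entropy in bits. *)

theory Defs
  imports "HOL-Probability.Probability"
begin

text \<open>
  A version of \<open>dQ/dP\<close> is a real-valued Borel function that agrees \<open>P\<close>-almost everywhere with
  \<^const>\<open>RN_deriv\<close>; for \<open>Q \<lless> P\<close> with \<open>Q\<close> finite the latter is almost everywhere finite, so
  \<^const>\<open>enn2real\<close> loses nothing.
\<close>

definition RN_version :: "'a measure \<Rightarrow> 'a measure \<Rightarrow> ('a \<Rightarrow> real) \<Rightarrow> bool" where
  "RN_version P Q r \<longleftrightarrow>
     r \<in> borel_measurable P \<and> (AE x in P. r x = enn2real (RN_deriv P Q x))"

text \<open>Indices start at 1; the values at 0 are placeholders that are never used.\<close>

fun grs_L :: "'a measure \<Rightarrow> 'a measure \<Rightarrow> ('a \<Rightarrow> real) \<Rightarrow> nat \<Rightarrow> real"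
  and grs_S :: "'a measure \<Rightarrow> 'a measure \<Rightarrow> ('a \<Rightarrow> real) \<Rightarrow> nat \<Rightarrow> real"
where
  "grs_L P Q r 0 = 0"
| "grs_L P Q r (Suc 0) = 0"
| "grs_L P Q r (Suc (Suc k)) = grs_L P Q r (Suc k) + grs_S P Q r (Suc k)"
| "grs_S P Q r 0 = 0"
| "grs_S P Q r (Suc 0) = 1"
| "grs_S P Q r (Suc (Suc k)) =
     (let l = grs_L P Q r (Suc k) + grs_S P Q r (Suc k);
          H = {y \<in> space P. l \<le> r y}
      in measure Q H - l * measure P H)"

text \<open>If \<open>grs_S P Q r k = 0\<close>, the quotient below is 0 by the convention \<open>x / 0 = 0\<close>.\<close>

definition grs_beta :: "'a measure \<Rightarrow> 'a measure \<Rightarrow> ('a \<Rightarrow> real) \<Rightarrow> nat \<Rightarrow> 'a \<Rightarrow> real" where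
  "grs_beta P Q r k x = min 1 (max 0 ((r x - grs_L P Q r k) / grs_S P Q r k))"

text \<open>The infimum of the empty set of extended naturals is \<open>\<infinity>\<close>: the run never stops.\<close>

definition grs_index ::
  "'a measure \<Rightarrow> 'a measure \<Rightarrow> ('a \<Rightarrow> real) \<Rightarrow> (nat \<Rightarrow> 'w \<Rightarrow> 'a) \<Rightarrow> (nat \<Rightarrow> 'w \<Rightarrow> real) \<Rightarrow> 'w \<Rightarrow> enat"
where
  "grs_index P Q r X U \<omega> =
     (INF k \<in> {k. 1 \<le> k \<and> U k \<omega> \<le> grs_beta P Q r k (X k \<omega>)}. enat k)"

text \<open>
  Both quantities below take values in \<open>[0, \<infinity>]\<close>; their summand and integrand are nonnegative since
  the probabilities are at most 1, and \<open>0 * log 2 0 = 0\<close> holds by definition. The library's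
  \<^const>\<open>prob_space.entropy\<close> is real-valued and does not represent infinite entropy.
\<close>

definition shannon_entropy :: "'w measure \<Rightarrow> ('w \<Rightarrow> 'b) \<Rightarrow> ennreal" where
  "shannon_entropy M K =
     (let p = (\<lambda>k. measure M {\<omega> \<in> space M. K \<omega> = k})
      in \<integral>\<^sup>+ k. ennreal (- (p k * log 2 (p k))) \<partial>count_space UNIV)"

definition RN_tail :: "'a measure \<Rightarrow> 'a measure \<Rightarrow> real \<Rightarrow> real" where
  "RN_tail P Q h = measure P {y \<in> space P. ennreal h \<le> RN_deriv P Q y}"

definition D_CS :: "'a measure \<Rightarrow> 'a measure \<Rightarrow> ennreal" where
  "D_CS Q P =
     (\<integral>\<^sup>+ h \<in> {0..}. ennreal (- (RN_tail P Q h * log 2 (RN_tail P Q h))) \<partial>lborel)"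

end

theory Submission
  imports Defs
begin

text \<open>
  Write \<open>w h = P (dQ/dP \<ge> h)\<close>. Then \<open>S k = \<integral>\<^sub>L\<^sub>k\<^sup>\<infinity> w\<close> is the probability that the first \<open>k - 1\<close>
  proposals are rejected, so \<open>K = k\<close> has probability \<open>p = S k - S (k+1)\<close>, the integral of \<open>w\<close> over
  \<open>[L k, L (k+1))\<close>, an interval of length \<open>S k\<close>. In nats, the potential
  \<open>S k * ln (e + w (L k)) - S k * ln (S k)\<close> starts at \<open>ln (e + 1)\<close>, stays nonnegative, and
  at step \<open>k\<close> drops by at least the excess of \<open>- p * ln p\<close> over the integral of \<open>- w * ln w\<close> on that
  interval. With \<open>b = w (L k)\<close>, \<open>c = w (L (k+1))\<close> and acceptance probability \<open>a = p / S k\<close>, the drop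
  follows from the bound \<open>x * ln x \<le> x * ln b - c * (1 - x / b)\<close> on \<open>[c, b]\<close>, which makes the
  integral linear in \<open>a\<close>, and from Gibbs' inequality for the weights \<open>1 - a\<close> and \<open>a\<close>.
\<close>

section \<open>Logarithmic inequalities behind the one-step bound\<close>

lemma mult_ln_le_weighted:
  fixes a y z :: real
  assumes "0 \<le> a" "0 < y" "0 < z"
  shows "a * ln y - a * ln a \<le> a * ln z + y / z - a"
proof (cases "a = 0")
  case False
  with assms have a: "0 < a" by simp
  \<comment> \<open>This is \<open>ln u \<le> u - 1\<close> at \<open>u = y / (a * z)\<close>. The
    parameter \<open>z\<close> stays free so that two instances can share it.\<close>
  have "a * ln (y / (a * z)) \<le> a * (y / (a * z) - 1)"
    using a assms by (intro mult_left_mono ln_le_minus_one) auto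
  also have "\<dots> = y / z - a"
    using a by (simp add: field_simps)
  also have "ln (y / (a * z)) = ln y - ln a - ln z"
    using a assms by (simp add: ln_div ln_mult)
  finally show ?thesis
    by (simp add: algebra_simps)
qed (use assms in simp)

text \<open>Adding \<open>mult_ln_le_weighted\<close> for both weights with the common value
  \<open>z = x + y\<close> makes the linear terms cancel, because
  \<open>x / z + y / z = 1 = (1 - a) + a\<close>.\<close>

lemma gibbs_two_points:
  fixes a x y :: real
  assumes "0 \<le> a" "a \<le> 1" "0 < x" "0 < y"
  shows "(1 - a) * ln x - (1 - a) * ln (1 - a) + (a * ln y - a * ln a) \<le> ln (x + y)"
proof -
  have "(1 - a) * ln x - (1 - a) * ln (1 - a) \<le> (1 - a) * ln (x + y) + x / (x + y) - (1 - a)"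
    using assms by (intro mult_ln_le_weighted) auto
  moreover have "a * ln y - a * ln a \<le> a * ln (x + y) + y / (x + y) - a"
    using assms by (intro mult_ln_le_weighted) auto
  moreover have "x / (x + y) + y / (x + y) = 1"
    using assms by (simp add: add_divide_distrib [symmetric])
  ultimately show ?thesis
    by (simp add: algebra_simps)
qed

lemma exp_le_secant:
  fixes t :: real
  assumes "0 \<le> t" "t \<le> 1"
  shows "exp t \<le> 1 + (exp 1 - 1) * t"
proof -
  have "convex_on UNIV (exp :: real \<Rightarrow> real)"
    by (rule exp_convex)
  then have "exp ((1 - t) *\<^sub>R 0 + t *\<^sub>R 1) \<le> (1 - t) * exp 0 + t * exp (1::real)"
    using assms by (intro convex_onD) auto
  then show ?thesis
    by (simp add: algebra_simps)
qed

text \<open>The core of \<open>potential_step\<close>, scaled by \<open>S k\<close>. Gibbs'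
  inequality with \<open>x = exp 1 + c\<close> and \<open>y = b * exp (c / b)\<close> absorbs
  \<open>a * ln b + c / b * a\<close> and removes \<open>a\<close>. What remains is
  \<open>exp 1 + c + b * exp (c / b) \<le> (exp 1 + b) * exp c\<close>. Here the constant
  \<open>exp 1\<close> of the potential is decisive: the secant of \<open>exp\<close> bounds the
  left side by \<open>exp 1 + b + exp 1 * c\<close>, whose last term is at most
  \<open>(exp 1 + b) * c\<close>.\<close>

lemma acceptance_tradeoff:
  fixes a b c :: real
  assumes a: "0 \<le> a" "a \<le> 1" and b: "0 < b" and c: "0 \<le> c" "c \<le> b"
  shows "(1 - a) * ln (exp 1 + c) - (1 - a) * ln (1 - a) - a * ln a + a * ln b + c / b * a - c
    \<le> ln (exp 1 + b)"
proof -
  define t where "t = c / b"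
  have t: "0 \<le> t" "t \<le> 1" and ct: "c = b * t"
    using assms by (auto simp: t_def)
  have pos: "0 < exp 1 + c" "0 < b * exp t" "0 < exp 1 + b"
    using assms by (auto intro: add_pos_nonneg add_pos_pos)
  have "(1 - a) * ln (exp 1 + c) - (1 - a) * ln (1 - a) + (a * ln (b * exp t) - a * ln a)
      \<le> ln (exp 1 + c + b * exp t)"
    using a pos by (intro gibbs_two_points) auto
  moreover have "ln (b * exp t) = ln b + t"
    using b by (simp add: ln_mult)
  moreover have "ln (exp 1 + c + b * exp t) \<le> ln ((exp 1 + b) * exp c)"
  proof (rule ln_mono)
    have "b * exp t \<le> b * (1 + (exp 1 - 1) * t)"
      using b exp_le_secant [OF t] by (intro mult_left_mono) auto
    then have "exp 1 + c + b * exp t \<le> exp 1 + b + exp 1 * c"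
      by (simp add: ct algebra_simps)
    also have "\<dots> \<le> exp 1 + b + exp 1 * c + b * c"
      using b c by simp
    also have "\<dots> = (exp 1 + b) * (1 + c)"
      by (simp add: algebra_simps)
    also have "\<dots> \<le> (exp 1 + b) * exp c"
      using pos by (intro mult_left_mono) auto
    finally show "exp 1 + c + b * exp t \<le> (exp 1 + b) * exp c" .
  qed (use pos in \<open>auto intro: add_pos_pos\<close>)
  moreover have "ln ((exp 1 + b) * exp c) = ln (exp 1 + b) + c"
    using pos by (simp add: ln_mult)
  ultimately show ?thesis
    by (simp add: t_def algebra_simps)
qed

text \<open>Use \<open>ln (x / b) \<le> x / b - 1\<close>, then lower the factor \<open>x\<close> in
  \<open>x * ((b - x) / b)\<close> to \<open>c\<close>. The result is affine in \<open>x\<close>, so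
  integrating it along \<open>tail\<close> needs only the length of the interval and the integral of
  \<open>tail\<close>.\<close>

lemma mult_ln_le_chord:
  fixes b c x :: real
  assumes "0 \<le> c" "c \<le> x" "x \<le> b" "0 < b"
  shows "x * ln x \<le> x * ln b - c + c / b * x"
proof (cases "x = 0")
  case False
  with assms have x: "0 < x" by simp
  have "x * ln (x / b) \<le> x * (x / b - 1)"
    using assms x by (intro mult_left_mono ln_le_minus_one) auto
  also have "\<dots> = - (x * ((b - x) / b))"
    using assms by (simp add: field_simps)
  also have "\<dots> \<le> - (c * ((b - x) / b))"
    using assms by (simp add: mult_right_mono divide_right_mono)
  also have "\<dots> = - c + c / b * x"
    using assms by (simp add: field_simps)
  also have "ln (x / b) = ln x - ln b"
    using x assms by (simp add: ln_div)
  finally show ?thesis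
    by (simp add: algebra_simps)
qed (use assms in simp)

text \<open>In nats, like all estimates below; the conversion to bits happens only in the final
  theorem.\<close>

definition plogp :: "real \<Rightarrow> real" where "plogp x = - (x * ln x)"

lemma plogp_nonneg: "0 \<le> x \<Longrightarrow> x \<le> 1 \<Longrightarrow> 0 \<le> plogp x"
  by (cases "x = 0") (auto simp: plogp_def mult_le_0_iff)

lemma plogp_measurable [measurable]: "plogp \<in> borel_measurable borel"
  unfolding plogp_def [abs_def] by measurable

lemma plogp_le_1: "0 \<le> x \<Longrightarrow> x \<le> 1 \<Longrightarrow> plogp x \<le> 1"
  using mult_ln_le_weighted [of x 1 1] by (simp add: plogp_def)

section \<open>Excess of the density over a level, and its tail probabilities\<close>

locale greedy_rejection = prob_space P for P :: "'a measure" +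
  fixes Q :: "'a measure" and r :: "'a \<Rightarrow> real"
  assumes r_measurable [measurable]: "r \<in> borel_measurable P"
    and AE_r_nonneg: "AE x in P. 0 \<le> r x"
    and Q_eq_density: "Q = density P (\<lambda>x. ennreal (r x))"
    and prob_space_Q: "prob_space Q"
begin

text \<open>This form of \<open>S\<close> is visibly nonnegative and antitone in the level, unlike
  the difference \<open>measure Q H - l * measure P H\<close> in the recursion.\<close>

definition excess :: "real \<Rightarrow> real" where
  "excess l = (\<integral>x. max 0 (r x - l) \<partial>P)"

definition tail :: "real \<Rightarrow> real" where
  "tail h = prob {x \<in> space P. h \<le> r x}"

lemma nn_integral_r: "(\<integral>\<^sup>+x. ennreal (r x) \<partial>P) = 1"
  using prob_space.emeasure_space_1 [OF prob_space_Q]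
  by (simp add: Q_eq_density emeasure_density cong: nn_integral_cong)

lemma integrable_r [simp, intro]: "integrable P r"
  using nn_integral_r AE_r_nonneg by (intro integrableI_nonneg) auto

lemma integral_r: "(\<integral>x. r x \<partial>P) = 1"
  using nn_integral_r AE_r_nonneg by (subst integral_eq_nn_integral) auto

lemma integrable_excess [simp, intro]: "integrable P (\<lambda>x. max 0 (r x - l))"
  by (intro integrable_max) auto

lemma excess_nonneg: "0 \<le> excess l"
  unfolding excess_def by (intro Bochner_Integration.integral_nonneg) auto

lemma excess_antimono: "l \<le> l' \<Longrightarrow> excess l' \<le> excess l"
  unfolding excess_def by (intro integral_mono) auto

lemma excess_0: "excess 0 = 1"
proof -
  have "excess 0 = (\<integral>x. r x \<partial>P)"
    unfolding excess_def using AE_r_nonneg by (intro integral_cong_AE) auto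
  then show ?thesis by (simp add: integral_r)
qed

text \<open>Both sides integrate the same function: \<open>(r x - l) * indicator ?H x\<close> is the
  positive part of \<open>r x - l\<close>.\<close>

lemma excess_eq_measure:
  "measure Q {y \<in> space P. l \<le> r y} - l * prob {y \<in> space P. l \<le> r y} = excess l"
proof -
  let ?H = "{y \<in> space P. l \<le> r y}"
  have int: "integrable P (\<lambda>x. r x * indicator ?H x)"
    by (intro integrable_real_mult_indicator) auto
  have "emeasure Q ?H = (\<integral>\<^sup>+x. ennreal (r x) * indicator ?H x \<partial>P)"
    by (simp add: Q_eq_density emeasure_density)
  also have "\<dots> = (\<integral>\<^sup>+x. ennreal (r x * indicator ?H x) \<partial>P)"
    by (intro nn_integral_cong) (auto simp: indicator_def)
  also have "\<dots> = ennreal (\<integral>x. r x * indicator ?H x \<partial>P)"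
    using AE_r_nonneg by (intro nn_integral_eq_integral int) auto
  finally have "measure Q ?H = (\<integral>x. r x * indicator ?H x \<partial>P)"
    using AE_r_nonneg by (auto simp: measure_def intro!: enn2real_ennreal integral_nonneg_AE)
  moreover have "prob ?H = (\<integral>x. indicator ?H x \<partial>P)"
    by simp
  ultimately have "measure Q ?H - l * prob ?H
      = (\<integral>x. r x * indicator ?H x \<partial>P) - (\<integral>x. l * indicator ?H x \<partial>P)"
    by simp
  also have "\<dots> = (\<integral>x. r x * indicator ?H x - l * indicator ?H x \<partial>P)"
    by (intro Bochner_Integration.integral_diff [symmetric] int integrable_mult_right) (auto simp: emeasure_eq_measure)
  also have "\<dots> = excess l"
    unfolding excess_def by (intro Bochner_Integration.integral_cong) (auto simp: indicator_def)
  finally show ?thesis .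
qed

text \<open>Clipping at \<open>s\<close> is a difference of two positive parts. The clipped
  integrand occurs twice below: as the length of a truncated interval in
  \<open>integral_tail\<close>, and as \<open>S\<close> times the acceptance probability in
  \<open>integral_grs_beta\<close>.\<close>

lemma excess_diff:
  assumes "0 \<le> s"
  shows "(\<integral>x. min s (max 0 (r x - l)) \<partial>P) = excess l - excess (l + s)"
proof -
  have "(\<integral>x. min s (max 0 (r x - l)) \<partial>P) = (\<integral>x. max 0 (r x - l) - max 0 (r x - (l + s)) \<partial>P)"
    using assms by (intro Bochner_Integration.integral_cong) auto
  also have "\<dots> = excess l - excess (l + s)"
    unfolding excess_def by (intro Bochner_Integration.integral_diff) auto
  finally show ?thesis .
qed

lemma tail_antimono: "h \<le> h' \<Longrightarrow> tail h' \<le> tail h"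
  unfolding tail_def by (intro finite_measure_mono) auto

lemma tail_nonneg: "0 \<le> tail h" and tail_le_1: "tail h \<le> 1"
  by (auto simp: tail_def)

lemma tail_measurable [measurable]: "tail \<in> borel_measurable borel"
proof -
  have "(\<lambda>h. - tail h) \<in> borel_measurable borel"
    by (intro borel_measurable_mono) (auto simp: mono_def tail_antimono)
  then show ?thesis by simp
qed

lemma set_integrable_tail:
  fixes f :: "real \<Rightarrow> real"
  assumes [measurable]: "f \<in> borel_measurable borel" and "\<And>h. \<bar>f (tail h)\<bar> \<le> B"
  shows "set_integrable lborel {l..<l'} (\<lambda>h. f (tail h))"
  unfolding set_integrable_def
proof (rule Bochner_Integration.integrable_bound [where f = "\<lambda>h. indicator {l..<l'} h * B"])
  show "integrable lborel (\<lambda>h. indicator {l..<l'} h * B)"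
    by (cases "l \<le> l'") (auto simp: emeasure_lborel_Ico)
qed (use order_trans [OF assms(2) abs_ge_self] in \<open>auto simp: indicator_def\<close>)

text \<open>Layer-cake argument: write \<open>tail h\<close> as the integral of an indicator and
  swap the integrals. The inner integral is then the length of the part of
  \<open>{l..<l + s}\<close> that lies below \<open>r x\<close>.\<close>

lemma integral_tail:
  assumes "0 \<le> s"
  shows "(LINT h:{l..<l + s}|lborel. tail h) = excess l - excess (l + s)"
proof -
  interpret pair_sigma_finite P lborel
    by unfold_locales
  have int: "set_integrable lborel {l..<l + s} tail"
    using set_integrable_tail [of "\<lambda>x. x" 1] tail_nonneg tail_le_1 by auto
  have "ennreal (LINT h:{l..<l + s}|lborel. tail h)
      = (\<integral>\<^sup>+h. ennreal (indicator {l..<l + s} h * tail h) \<partial>lborel)"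
    using int unfolding set_lebesgue_integral_def set_integrable_def
    by (subst nn_integral_eq_integral) (auto simp: tail_nonneg)
  also have "\<dots> = (\<integral>\<^sup>+h. (\<integral>\<^sup>+x. indicator {l..<l + s} h * indicator {x \<in> space P. h \<le> r x} x \<partial>P) \<partial>lborel)"
    by (intro nn_integral_cong) (auto simp: tail_def nn_integral_cmult emeasure_eq_measure ennreal_mult ennreal_indicator)
  also have "\<dots> = (\<integral>\<^sup>+h. (\<integral>\<^sup>+x. indicator {l..<l + s} h * indicator {..r x} h \<partial>P) \<partial>lborel)"
    by (intro nn_integral_cong) (auto simp: indicator_def)
  also have "\<dots> = (\<integral>\<^sup>+x. (\<integral>\<^sup>+h. indicator {l..<l + s} h * indicator {..r x} h \<partial>lborel) \<partial>P)"
    by (intro Fubini') (auto simp: indicator_def)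
  also have "\<dots> = (\<integral>\<^sup>+x. ennreal (min s (max 0 (r x - l))) \<partial>P)"
  proof (intro nn_integral_cong)
    fix x
    have "(\<integral>\<^sup>+h. indicator {l..<l + s} h * indicator {..r x} h \<partial>lborel)
        = (\<integral>\<^sup>+h. indicator ({l..<l + s} \<inter> {..r x}) h \<partial>lborel)"
      by (intro nn_integral_cong) (auto simp: indicator_def)
    also have "\<dots> = emeasure lborel ({l..<l + s} \<inter> {..r x})"
      by simp
    also have "\<dots> = ennreal (min s (max 0 (r x - l)))"
    proof -
      \<comment> \<open>The right end stays open only if \<open>r x\<close> reaches
        \<open>l + s\<close>; otherwise \<open>r x\<close> itself belongs to the set, which is empty
        for \<open>r x < l\<close>.\<close>
      have "{l..<l + s} \<inter> {..r x} = (if l + s \<le> r x then {l..<l + s} else {l..r x})"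
        by auto
      then show ?thesis
        using assms by (auto simp: emeasure_lborel_Icc_eq min_def max_def)
    qed
    finally show "(\<integral>\<^sup>+h. indicator {l..<l + s} h * indicator {..r x} h \<partial>lborel)
        = ennreal (min s (max 0 (r x - l)))" .
  qed
  also have "\<dots> = ennreal (\<integral>x. min s (max 0 (r x - l)) \<partial>P)"
    using assms by (intro nn_integral_eq_integral integrable_min) auto
  finally show ?thesis
    using assms
    by (simp add: excess_diff excess_antimono set_lebesgue_integral_def integral_nonneg tail_nonneg)
qed

lemma excess_tendsto_0: "(excess \<longlongrightarrow> 0) at_top"
proof -
  have "((\<lambda>l. \<integral>x. max 0 (r x - l) \<partial>P) \<longlongrightarrow> (\<integral>x. 0 \<partial>P)) at_top"
  proof (rule integral_dominated_convergence_at_top [where w = "\<lambda>x. \<bar>r x\<bar>"])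
    show "AE x in P. ((\<lambda>l. max 0 (r x - l)) \<longlongrightarrow> 0) at_top"
    proof (rule AE_I2)
      fix x
      show "((\<lambda>l. max 0 (r x - l)) \<longlongrightarrow> 0) at_top"
        by (intro tendsto_eventually eventually_mono [OF eventually_ge_at_top [of "r x"]]) auto
    qed
    show "\<forall>\<^sub>F l in at_top. AE x in P. norm (max 0 (r x - l)) \<le> \<bar>r x\<bar>"
      using eventually_ge_at_top [of 0] by eventually_elim auto
  qed auto
  then show ?thesis by (simp add: excess_def [abs_def])
qed

lemma set_integrable_plogp_tail: "set_integrable lborel {l..<l'} (\<lambda>h. plogp (tail h))"
  using tail_nonneg tail_le_1 plogp_nonneg plogp_le_1 by (intro set_integrable_tail [of plogp 1]) auto

text \<open>A function of the level alone, since \<open>S k\<close> is \<open>excess (L k)\<close>.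
  One round of the algorithm thereby becomes a move from \<open>l\<close> to
  \<open>l + excess l\<close>, without reference to \<open>k\<close>.\<close>

definition potential :: "real \<Rightarrow> real" where
  "potential l = excess l * ln (exp 1 + tail l) + plogp (excess l)"

text \<open>Since \<open>p + s' = s\<close>, the \<open>ln s\<close> parts of
  \<open>plogp p\<close>, \<open>plogp s'\<close> and \<open>plogp s\<close> cancel. Once the
  integral is replaced by its lower bound in \<open>s\<close> and \<open>p\<close>, what remains is
  \<open>acceptance_tradeoff\<close> multiplied by \<open>s\<close>.\<close>

lemma potential_step:
  fixes l :: real
  defines "s \<equiv> excess l"
  assumes "s \<le> 1"
  shows "plogp (s - excess (l + s)) + potential (l + s)
    \<le> (LINT h:{l..<l + s}|lborel. plogp (tail h)) + potential l"
proof (cases "s = 0")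
  case True
  then show ?thesis by (simp add: s_def set_lebesgue_integral_def plogp_def)
next
  case False
  with excess_nonneg [of l] have s: "0 < s" by (simp add: s_def)
  define s' p a b c D where "s' = excess (l + s)" and "p = s - s'" and "a = p / s"
    and "b = tail l" and "c = tail (l + s)" and "D = (LINT h:{l..<l + s}|lborel. plogp (tail h))"
  have s': "0 \<le> s'" "s' \<le> s"
    using excess_nonneg excess_antimono [of l "l + s"] s by (auto simp: s'_def s_def)
  have bc: "0 \<le> c" "c \<le> b"
    using s by (auto simp: b_def c_def tail_nonneg intro: tail_antimono)
  \<comment> \<open>If \<open>tail l\<close> vanished, \<open>r\<close> would be below
    \<open>l\<close> almost everywhere and the excess over \<open>l\<close> would be 0.\<close>
  have b: "0 < b"
  proof (rule ccontr)
    assume "\<not> 0 < b"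
    then have "prob {x \<in> space P. l \<le> r x} = 0"
      using tail_nonneg [of l] by (auto simp: b_def tail_def intro: antisym)
    then have "AE x in P. x \<notin> {x \<in> space P. l \<le> r x}"
      by (intro AE_not_in) (auto simp: null_setsI emeasure_eq_measure)
    then have "AE x in P. max 0 (r x - l) = 0"
      by auto
    then have "excess l = 0"
      unfolding excess_def by (intro integral_eq_zero_AE)
    with s show False by (simp add: s_def)
  qed
  have p: "(LINT h:{l..<l + s}|lborel. tail h) = p"
    using integral_tail [of s l] s by (simp add: p_def s_def s'_def)
  have int: "set_integrable lborel {l..<l + s} tail"
    using set_integrable_tail [of "\<lambda>x. x" 1] tail_nonneg tail_le_1 by auto
  have int1: "set_integrable lborel {l..<l + s} (\<lambda>h. c)"
    using s by (simp add: set_integrable_def emeasure_lborel_Ico)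
  have int2: "set_integrable lborel {l..<l + s} (\<lambda>h. (ln b + c / b) * tail h)"
    using int by simp
  \<comment> \<open>The affine minorant of \<open>plogp (tail h)\<close> supplied by
    \<open>mult_ln_le_chord\<close> has an integral that depends on \<open>tail\<close> only through
    \<open>p\<close>, \<open>b\<close> and \<open>c\<close>.\<close>
  have "c * s - (ln b + c / b) * p = (LINT h:{l..<l + s}|lborel. c - (ln b + c / b) * tail h)"
  proof -
    have "(LINT h:{l..<l + s}|lborel. c) = c * s"
      using s by (simp add: set_lebesgue_integral_def)
    then show ?thesis
      using set_integral_diff(2) [OF int1 int2] p by simp
  qed
  also have "\<dots> \<le> D"
    unfolding D_def
  proof (rule set_integral_mono)
    fix h assume "h \<in> {l..<l + s}"
    then have "c \<le> tail h" "tail h \<le> b"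
      by (auto simp: b_def c_def intro: tail_antimono)
    from mult_ln_le_chord [OF bc(1) this b]
    show "c - (ln b + c / b) * tail h \<le> plogp (tail h)"
      by (simp add: plogp_def algebra_simps)
  qed (use int1 int2 set_integrable_plogp_tail in auto)
  finally have D: "c * s - (ln b + c / b) * p \<le> D" .
  have a: "0 \<le> a" "a \<le> 1" and pa: "p = a * s" and sa: "s' = (1 - a) * s"
    using s s' by (auto simp: a_def p_def field_simps)
  \<comment> \<open>The logarithm of \<open>a * s\<close> does not split at \<open>a = 0\<close>,
    but there the prefactor \<open>p\<close> vanishes. In \<open>ln2\<close> the same happens to
    \<open>s'\<close> at \<open>a = 1\<close>.\<close>
  have ln1: "p * ln p = p * ln a + p * ln s"
    using s a by (cases "a = 0") (simp_all add: pa ln_mult distrib_left)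
  have ln2: "s' * ln s' = s' * ln (1 - a) + s' * ln s"
    using s a by (cases "a = 1") (simp_all add: sa ln_mult distrib_left)
  have "((1 - a) * ln (exp 1 + c) - (1 - a) * ln (1 - a) - a * ln a + a * ln b + c / b * a - c) * s
      \<le> ln (exp 1 + b) * s"
    using acceptance_tradeoff [OF a b bc] s by (intro mult_right_mono) auto
  then have "s' * ln (exp 1 + c) - s' * ln (1 - a) - p * ln a + p * ln b + c / b * p - c * s
      \<le> s * ln (exp 1 + b)"
    by (simp add: pa sa algebra_simps)
  moreover have "p * ln s + s' * ln s = s * ln s"
    by (simp add: p_def algebra_simps)
  ultimately have "plogp p + (s' * ln (exp 1 + c) + plogp s') \<le> D + (s * ln (exp 1 + b) + plogp s)"
    using D ln1 ln2 by (simp add: plogp_def algebra_simps)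
  then show ?thesis
    by (simp add: potential_def s_def [symmetric] s'_def [symmetric] b_def [symmetric] c_def [symmetric]
        D_def [symmetric] p_def)
qed


section \<open>The sequences of the algorithm and the summed bound\<close>

lemma grs_S_Suc: "grs_S P Q r (Suc k) = excess (grs_L P Q r (Suc k))"
  \<comment> \<open>For \<open>k = 0\<close> the initial value 1 is the total mass of
    \<open>Q\<close>, which is \<open>excess 0\<close>.\<close>
  by (cases k) (simp_all add: excess_0 Let_def excess_eq_measure)

lemma grs_L_nonneg: "0 \<le> grs_L P Q r (Suc k)"
  by (induction k) (auto simp: grs_S_Suc excess_nonneg)

lemma grs_S_nonneg: "0 \<le> grs_S P Q r (Suc k)"
  by (simp add: grs_S_Suc excess_nonneg)

lemma grs_S_le_1: "grs_S P Q r (Suc k) \<le> 1"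
  using excess_antimono [OF grs_L_nonneg] by (simp add: grs_S_Suc excess_0)

lemma grs_S_Suc_Suc_le: "grs_S P Q r (Suc (Suc k)) \<le> grs_S P Q r (Suc k)"
  using excess_nonneg [of "grs_L P Q r (Suc k)"]
  by (simp only: grs_S_Suc grs_L.simps) (intro excess_antimono, simp)

text \<open>A positive limit would bound all increments of \<open>L\<close> from below, so
  \<open>L\<close> would diverge and \<open>S\<close>, the excess over \<open>L\<close>, would tend
  to 0 after all. This later gives almost sure termination.\<close>

lemma grs_S_tendsto_0: "(\<lambda>k. grs_S P Q r (Suc k)) \<longlonglongrightarrow> 0"
proof -
  let ?S = "\<lambda>k. grs_S P Q r (Suc k)" and ?L = "\<lambda>k. grs_L P Q r (Suc k)"
  have "decseq ?S"
    by (intro decseq_SucI grs_S_Suc_Suc_le)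
  then obtain s where s: "?S \<longlonglongrightarrow> s" and le: "\<And>k. s \<le> ?S k"
    using decseq_convergent grs_S_nonneg by metis
  have "0 \<le> s"
    using s grs_S_nonneg by (intro LIMSEQ_le_const) auto
  moreover have False if "0 < s"
  proof -
    have le_L: "real k * s \<le> ?L k" for k
    proof (induction k)
      case (Suc k)
      then show ?case using le [of k] by (simp add: algebra_simps)
    qed simp
    have "filterlim (\<lambda>k. real k * s) at_top sequentially"
      using that by (intro filterlim_at_top_mult_tendsto_pos [OF tendsto_const] filterlim_real_sequentially)
    then have "filterlim ?L at_top sequentially"
      by (rule filterlim_at_top_mono) (intro always_eventually allI le_L)
    from filterlim_compose [OF excess_tendsto_0 this] have "?S \<longlonglongrightarrow> 0"
      unfolding grs_S_Suc .
    from LIMSEQ_unique [OF s this] that show False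
      by simp
  qed
  ultimately have "s = 0"
    by (metis less_eq_real_def)
  with s show ?thesis
    by simp
qed

lemma grs_beta_bounds: "0 \<le> grs_beta P Q r k x" "grs_beta P Q r k x \<le> 1"
  by (auto simp: grs_beta_def)

lemma grs_beta_measurable [measurable]: "grs_beta P Q r k \<in> borel_measurable P"
  unfolding grs_beta_def [abs_def] by measurable

text \<open>Multiplying by \<open>S\<close> undoes the quotient in \<open>grs_beta\<close> and keeps
  the identity valid for \<open>S = 0\<close>, where both sides vanish.\<close>

lemma integral_grs_beta:
  "(\<integral>x. grs_beta P Q r (Suc k) x \<partial>P) * grs_S P Q r (Suc k)
    = grs_S P Q r (Suc k) - grs_S P Q r (Suc (Suc k))"
proof -
  define s l where "s = grs_S P Q r (Suc k)" and "l = grs_L P Q r (Suc k)"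
  have s: "0 \<le> s" "grs_S P Q r (Suc (Suc k)) = excess (l + s)" "s = excess l"
    using grs_S_nonneg by (auto simp only: s_def l_def grs_S_Suc grs_L.simps)
  have "(\<integral>x. grs_beta P Q r (Suc k) x \<partial>P) * s = (\<integral>x. min s (max 0 (r x - l)) \<partial>P)"
  proof (cases "s = 0")
    case False
    with s have "0 < s" by simp
    then have "grs_beta P Q r (Suc k) x * s = min s (max 0 (r x - l))" for x
      by (auto simp: grs_beta_def s_def [symmetric] l_def [symmetric] min_def max_def field_simps)
    then show ?thesis
      by (subst integral_mult_left_zero [symmetric]) simp
  qed (auto simp: min_def)
  then show ?thesis
    using excess_diff [OF s(1), of l] s by (simp add: s_def)
qed

text \<open>Telescoping of \<open>potential_step\<close>, the intervals between consecutive levels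
  being adjacent. Finite sums and real-valued integrals let the potentials cancel.\<close>

lemma sum_plogp_le:
  "(\<Sum>k<n. plogp (grs_S P Q r (Suc k) - grs_S P Q r (Suc (Suc k)))) + potential (grs_L P Q r (Suc n))
    \<le> (LINT h:{0..<grs_L P Q r (Suc n)}|lborel. plogp (tail h)) + ln (exp 1 + 1)"
proof (induction n)
  case 0
  \<comment> \<open>The additive constant of the theorem arises here: the excess over level 0 is 1,
    so the potential there is \<open>ln (exp 1 + tail 0)\<close>.\<close>
  have "ln (exp 1 + tail 0) \<le> ln (exp 1 + 1)"
    using tail_nonneg [of 0] tail_le_1 [of 0] by (intro ln_mono) (auto intro: add_pos_nonneg)
  then show ?case
    by (simp add: potential_def excess_0 plogp_def set_lebesgue_integral_def)
next
  case (Suc n)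
  define s l where "s = grs_S P Q r (Suc n)" and "l = grs_L P Q r (Suc n)"
  have s: "0 \<le> s" "s \<le> 1" "0 \<le> l" "s = excess l"
    using grs_S_nonneg grs_S_le_1 grs_L_nonneg by (auto simp: s_def l_def grs_S_Suc)
  have S: "grs_S P Q r (Suc (Suc n)) = excess (l + s)"
    by (simp only: s_def l_def grs_S_Suc grs_L.simps)
  have "(LINT h:{0..<l + s}|lborel. plogp (tail h))
      = (LINT h:{0..<l}|lborel. plogp (tail h)) + (LINT h:{l..<l + s}|lborel. plogp (tail h))"
    using s by (subst set_integral_Un [symmetric])
      (auto simp: ivl_disj_un_two set_integrable_plogp_tail)
  moreover have "plogp (s - excess (l + s)) + potential (l + s)
      \<le> (LINT h:{l..<l + s}|lborel. plogp (tail h)) + potential l"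
    using potential_step [of l] s by simp
  ultimately show ?case
    using Suc S by (simp del: grs_S.simps add: s_def [symmetric] l_def [symmetric])
qed

text \<open>Each partial sum drops its nonnegative potential and extends a nonnegative integrand to
  the half-line. The bound is uniform in \<open>n\<close>, and the integral on the right may be
  infinite.\<close>

lemma suminf_plogp_le:
  "(\<Sum>k. ennreal (plogp (grs_S P Q r (Suc k) - grs_S P Q r (Suc (Suc k)))))
    \<le> (\<integral>\<^sup>+h\<in>{0..}. ennreal (plogp (tail h)) \<partial>lborel) + ennreal (ln (exp 1 + 1))"
proof (rule suminf_le_const)
  fix n
  let ?l = "grs_L P Q r (Suc n)"
  let ?I = "LINT h:{0..<?l}|lborel. plogp (tail h)"
  have diff: "0 \<le> grs_S P Q r (Suc k) - grs_S P Q r (Suc (Suc k))"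
      "grs_S P Q r (Suc k) - grs_S P Q r (Suc (Suc k)) \<le> 1" for k
    using grs_S_Suc_Suc_le [of k] grs_S_nonneg [of "Suc k"] grs_S_le_1 [of k] by linarith+
  have "0 \<le> potential ?l"
    using tail_nonneg [of ?l] grs_S_nonneg [of n] grs_S_le_1 [of n]
    by (auto simp: potential_def grs_S_Suc intro!: add_nonneg_nonneg mult_nonneg_nonneg plogp_nonneg ln_ge_zero add_increasing2)
  then have "(\<Sum>k<n. plogp (grs_S P Q r (Suc k) - grs_S P Q r (Suc (Suc k)))) \<le> ?I + ln (exp 1 + 1)"
    using sum_plogp_le [of n] by linarith
  then have "(\<Sum>k<n. ennreal (plogp (grs_S P Q r (Suc k) - grs_S P Q r (Suc (Suc k)))))
      \<le> ennreal (?I + ln (exp 1 + 1))"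
    using diff plogp_nonneg by (subst sum_ennreal) (auto simp del: grs_S.simps intro: ennreal_leI)
  also have "\<dots> = ennreal ?I + ennreal (ln (exp 1 + 1))"
    unfolding set_lebesgue_integral_def
    by (intro ennreal_plus Bochner_Integration.integral_nonneg)
      (auto simp: plogp_nonneg tail_nonneg tail_le_1 add_increasing2)
  also have "ennreal ?I = (\<integral>\<^sup>+h. ennreal (indicator {0..<?l} h * plogp (tail h)) \<partial>lborel)"
    using set_integrable_plogp_tail unfolding set_lebesgue_integral_def set_integrable_def
    by (subst nn_integral_eq_integral) (auto simp: plogp_nonneg tail_nonneg tail_le_1)
  also have "\<dots> \<le> (\<integral>\<^sup>+h\<in>{0..}. ennreal (plogp (tail h)) \<partial>lborel)"
    by (intro nn_integral_mono) (auto simp: indicator_def)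
  finally show "(\<Sum>k<n. ennreal (plogp (grs_S P Q r (Suc k) - grs_S P Q r (Suc (Suc k)))))
      \<le> (\<integral>\<^sup>+h\<in>{0..}. ennreal (plogp (tail h)) \<partial>lborel) + ennreal (ln (exp 1 + 1))"
    by (simp add: add_right_mono)
qed simp

end

section \<open>Independence of the pairs of proposal and uniform variable\<close>

lemma (in prob_space) vimage_INT_in_vimage_algebra:
  assumes "finite J" "J \<noteq> {}" "J \<subseteq> I"
    and X: "\<And>i. i \<in> I \<Longrightarrow> X i \<in> measurable M (N i)"
    and B: "\<And>j. j \<in> J \<Longrightarrow> B j \<in> sets (N j)"
  shows "(\<Inter>j\<in>J. X j -` B j \<inter> space M)
    \<in> sets (vimage_algebra (space M) (\<lambda>\<omega>. \<lambda>i\<in>I. X i \<omega>) (PiM I N))"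
proof (intro sets.finite_INT)
  fix j assume j: "j \<in> J"
  \<comment> \<open>An event of one coordinate is the preimage of a cylinder set under the map of
    the whole family, and independence of the two families is assumed for such preimages.\<close>
  have "(\<lambda>\<omega>. \<lambda>i\<in>I. X i \<omega>) -` ((\<lambda>f. f j) -` B j \<inter> space (PiM I N)) \<inter> space M
      \<in> sets (vimage_algebra (space M) (\<lambda>\<omega>. \<lambda>i\<in>I. X i \<omega>) (PiM I N))"
    using j assms by (intro in_vimage_algebra measurable_sets [OF measurable_component_singleton]) auto
  also have "(\<lambda>\<omega>. \<lambda>i\<in>I. X i \<omega>) -` ((\<lambda>f. f j) -` B j \<inter> space (PiM I N)) \<inter> space M = X j -` B j \<inter> space M"
    using j \<open>J \<subseteq> I\<close> measurable_space [OF X] by (auto simp: space_PiM)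
  finally show "X j -` B j \<inter> space M
      \<in> sets (vimage_algebra (space M) (\<lambda>\<omega>. \<lambda>i\<in>I. X i \<omega>) (PiM I N))" .
qed (use assms in auto)

text \<open>Rectangles form an intersection-stable generator of the product sigma-algebra. For
  finitely many of them the probability factors first between the two families by \<open>XU\<close>
  and then over the indices; the factors are then regrouped by index.\<close>

lemma (in prob_space) indep_vars_Pair:
  assumes X: "indep_vars N X I" and U: "indep_vars N' U I"
    and XU: "indep_set
      (sets (vimage_algebra (space M) (\<lambda>\<omega>. \<lambda>i\<in>I. X i \<omega>) (PiM I N)))
      (sets (vimage_algebra (space M) (\<lambda>\<omega>. \<lambda>i\<in>I. U i \<omega>) (PiM I N')))"
  shows "indep_vars (\<lambda>i. N i \<Otimes>\<^sub>M N' i) (\<lambda>i \<omega>. (X i \<omega>, U i \<omega>)) I"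
proof -
  define G where "G i = {(\<lambda>\<omega>. (X i \<omega>, U i \<omega>)) -` A \<inter> space M | A.
    A \<in> {B \<times> C | B C. B \<in> sets (N i) \<and> C \<in> sets (N' i)}}" for i
  have mX: "\<And>i. i \<in> I \<Longrightarrow> X i \<in> measurable M (N i)" and mU: "\<And>i. i \<in> I \<Longrightarrow> U i \<in> measurable M (N' i)"
    using X U by (auto simp: indep_vars_def)
  have G_D: "\<exists>B C. B \<in> sets (N i) \<and> C \<in> sets (N' i)
      \<and> A = (X i -` B \<inter> space M) \<inter> (U i -` C \<inter> space M)" if "A \<in> G i" for A i
    using that by (fastforce simp: G_def)
  have "indep_sets G I"
  proof (rule indep_setsI)
    fix i assume "i \<in> I"
    then show "G i \<subseteq> events"
      using mX mU by (fastforce dest: G_D)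
  next
    fix A J assume J: "J \<noteq> {}" "J \<subseteq> I" "finite J" and A: "\<forall>j\<in>J. A j \<in> G j"
    from A have "\<forall>j\<in>J. \<exists>B C. B \<in> sets (N j) \<and> C \<in> sets (N' j)
        \<and> A j = (X j -` B \<inter> space M) \<inter> (U j -` C \<inter> space M)"
      by (intro ballI G_D) auto
    then obtain B where "\<forall>j\<in>J. \<exists>C. B j \<in> sets (N j) \<and> C \<in> sets (N' j)
        \<and> A j = (X j -` B j \<inter> space M) \<inter> (U j -` C \<inter> space M)"
      by (rule bchoice [THEN exE])
    then obtain C where "\<forall>j\<in>J. B j \<in> sets (N j) \<and> C j \<in> sets (N' j)
        \<and> A j = (X j -` B j \<inter> space M) \<inter> (U j -` C j \<inter> space M)"
      by (rule bchoice [THEN exE])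
    then have BC: "\<And>j. j \<in> J \<Longrightarrow> B j \<in> sets (N j)" "\<And>j. j \<in> J \<Longrightarrow> C j \<in> sets (N' j)"
      and A_eq: "\<And>j. j \<in> J \<Longrightarrow> A j = (X j -` B j \<inter> space M) \<inter> (U j -` C j \<inter> space M)"
      by auto
    \<comment> \<open>Two instances are needed: \<open>K = J\<close> for the whole intersection, and
      \<open>K = {j}\<close> to recombine the two factors of \<open>A j\<close>.\<close>
    have prod: "prob ((\<Inter>j\<in>K. X j -` B j \<inter> space M) \<inter> (\<Inter>j\<in>K. U j -` C j \<inter> space M))
        = (\<Prod>j\<in>K. prob (X j -` B j \<inter> space M)) * (\<Prod>j\<in>K. prob (U j -` C j \<inter> space M))"
      if K: "K \<noteq> {}" "K \<subseteq> J" for K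
    proof -
      have fin: "finite K" "K \<subseteq> I"
        using K J finite_subset by auto
      have "prob ((\<Inter>j\<in>K. X j -` B j \<inter> space M) \<inter> (\<Inter>j\<in>K. U j -` C j \<inter> space M))
          = prob (\<Inter>j\<in>K. X j -` B j \<inter> space M) * prob (\<Inter>j\<in>K. U j -` C j \<inter> space M)"
        using K BC fin mX mU by (intro indep_setD [OF XU] vimage_INT_in_vimage_algebra) auto
      also have "prob (\<Inter>j\<in>K. X j -` B j \<inter> space M) = (\<Prod>j\<in>K. prob (X j -` B j \<inter> space M))"
        using K BC fin by (intro indep_varsD [OF X]) auto
      also have "prob (\<Inter>j\<in>K. U j -` C j \<inter> space M) = (\<Prod>j\<in>K. prob (U j -` C j \<inter> space M))"
        using K BC fin by (intro indep_varsD [OF U]) auto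
      finally show ?thesis .
    qed
    have "(\<Inter>j\<in>J. A j) = (\<Inter>j\<in>J. X j -` B j \<inter> space M) \<inter> (\<Inter>j\<in>J. U j -` C j \<inter> space M)"
      using A_eq by auto
    then have "prob (\<Inter>j\<in>J. A j)
        = (\<Prod>j\<in>J. prob (X j -` B j \<inter> space M) * prob (U j -` C j \<inter> space M))"
      using prod [of J] J by (simp add: prod.distrib)
    also have "\<dots> = (\<Prod>j\<in>J. prob (A j))"
    proof (intro prod.cong refl)
      fix j assume "j \<in> J"
      then show "prob (X j -` B j \<inter> space M) * prob (U j -` C j \<inter> space M) = prob (A j)"
        using prod [of "{j}"] A_eq by simp
    qed
    finally show "prob (\<Inter>j\<in>J. A j) = (\<Prod>j\<in>J. prob (A j))" .
  qed
  moreover have "Int_stable (G i)" for i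
  proof (rule Int_stableI)
    fix A A' assume "A \<in> G i" "A' \<in> G i"
    then obtain B C B' C' where "B \<in> sets (N i)" "C \<in> sets (N' i)" "B' \<in> sets (N i)" "C' \<in> sets (N' i)"
      and "A = (\<lambda>\<omega>. (X i \<omega>, U i \<omega>)) -` (B \<times> C) \<inter> space M"
      and "A' = (\<lambda>\<omega>. (X i \<omega>, U i \<omega>)) -` (B' \<times> C') \<inter> space M"
      by (auto simp: G_def)
    then show "A \<inter> A' \<in> G i"
      unfolding G_def by (intro CollectI exI [of _ "(B \<inter> B') \<times> (C \<inter> C')"]) auto
  qed
  ultimately have "indep_sets (\<lambda>i. sigma_sets (space M) (G i)) I"
    by (intro indep_sets_sigma)
  moreover have "sigma_sets (space M) (G i)
      = {(\<lambda>\<omega>. (X i \<omega>, U i \<omega>)) -` A \<inter> space M | A. A \<in> sets (N i \<Otimes>\<^sub>M N' i)}" if "i \<in> I" for i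
    using that mX mU unfolding G_def sets_pair_measure
    by (intro sigma_sets_vimage_commute [symmetric]) (auto dest: measurable_space)
  ultimately show ?thesis
    unfolding indep_vars_def2 using mX mU by (auto cong: indep_sets_cong)
qed

text \<open>Independence within one round as an equality of laws, the form in which \<open>U\<close>
  can be integrated out. Agreement on rectangles suffices.\<close>

lemma (in prob_space) distr_Pair_of_indep_set_vimage_algebra:
  assumes XU: "indep_set
      (sets (vimage_algebra (space M) (\<lambda>\<omega>. \<lambda>i\<in>I. X i \<omega>) (PiM I N)))
      (sets (vimage_algebra (space M) (\<lambda>\<omega>. \<lambda>i\<in>I. U i \<omega>) (PiM I N')))"
    and X: "\<And>i. i \<in> I \<Longrightarrow> X i \<in> measurable M (N i)"
    and U: "\<And>i. i \<in> I \<Longrightarrow> U i \<in> measurable M (N' i)"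
    and i: "i \<in> I"
  shows "distr M (N i) (X i) \<Otimes>\<^sub>M distr M (N' i) (U i)
    = distr M (N i \<Otimes>\<^sub>M N' i) (\<lambda>\<omega>. (X i \<omega>, U i \<omega>))"
proof (rule pair_measure_eqI)
  have [measurable]: "X i \<in> measurable M (N i)" "U i \<in> measurable M (N' i)"
    using X U i by auto
  show "sigma_finite_measure (distr M (N i) (X i))" "sigma_finite_measure (distr M (N' i) (U i))"
    by (simp_all add: prob_space_distr prob_space_imp_sigma_finite)
  fix B C assume "B \<in> sets (distr M (N i) (X i))" "C \<in> sets (distr M (N' i) (U i))"
  then have [measurable]: "B \<in> sets (N i)" "C \<in> sets (N' i)"
    by auto
  have "prob ((X i -` B \<inter> space M) \<inter> (U i -` C \<inter> space M))
      = prob (X i -` B \<inter> space M) * prob (U i -` C \<inter> space M)"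
    using vimage_INT_in_vimage_algebra [of "{i}" I X N "\<lambda>_. B"]
      vimage_INT_in_vimage_algebra [of "{i}" I U N' "\<lambda>_. C"] X U i
    by (intro indep_setD [OF XU]) auto
  moreover have "(\<lambda>\<omega>. (X i \<omega>, U i \<omega>)) -` (B \<times> C) \<inter> space M
      = (X i -` B \<inter> space M) \<inter> (U i -` C \<inter> space M)"
    by auto
  ultimately show "emeasure (distr M (N i) (X i)) B * emeasure (distr M (N' i) (U i)) C
      = emeasure (distr M (N i \<Otimes>\<^sub>M N' i) (\<lambda>\<omega>. (X i \<omega>, U i \<omega>))) (B \<times> C)"
    by (simp add: emeasure_distr emeasure_eq_measure ennreal_mult)
qed simp

section \<open>Acceptance probability of one round\<close>

lemma emeasure_uniform_le:
  fixes b :: real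
  assumes "0 \<le> b" "b \<le> 1"
  shows "emeasure (uniform_measure lborel {0<..<1}) {..b} = ennreal b"
proof -
  \<comment> \<open>At \<open>b = 1\<close> the right end is missing, because the open interval
    excludes it.\<close>
  have "{0<..<1} \<inter> {..b} = (if b = 1 then {0<..<1} else {0<..b})"
    using assms by auto
  then show ?thesis
    using assms divide_ennreal [of b 1] by auto
qed

text \<open>For a fixed proposal \<open>x\<close> the uniform variable accepts with probability
  \<open>b x\<close>; the product law permits averaging this over \<open>x\<close>.\<close>

lemma (in prob_space) prob_uniform_le:
  fixes X :: "'a \<Rightarrow> 'b" and U :: "'a \<Rightarrow> real"
  assumes [measurable]: "X \<in> measurable M N" "U \<in> borel_measurable M"
    and XU: "distr M N X \<Otimes>\<^sub>M distr M borel U = distr M (N \<Otimes>\<^sub>M borel) (\<lambda>\<omega>. (X \<omega>, U \<omega>))"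
    and U: "distr M borel U = uniform_measure lborel {0<..<1}"
    and b [measurable]: "b \<in> borel_measurable N" and b01: "\<And>x. 0 \<le> b x" "\<And>x. b x \<le> 1"
  shows "prob {\<omega> \<in> space M. U \<omega> \<le> b (X \<omega>)} = (\<integral>x. b x \<partial>distr M N X)"
proof -
  interpret U: prob_space "distr M borel U" by (rule prob_space_distr) simp
  interpret X: prob_space "distr M N X" by (rule prob_space_distr) simp
  let ?A = "{z \<in> space (N \<Otimes>\<^sub>M borel). snd z \<le> b (fst z)}"
  have "emeasure M {\<omega> \<in> space M. U \<omega> \<le> b (X \<omega>)}
      = emeasure (distr M (N \<Otimes>\<^sub>M borel) (\<lambda>\<omega>. (X \<omega>, U \<omega>))) ?A"
    by (subst emeasure_distr)
      (auto simp: space_pair_measure intro!: arg_cong [where f = "emeasure M"] measurable_space [OF assms(1)])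
  also have "\<dots> = emeasure (distr M N X \<Otimes>\<^sub>M distr M borel U) ?A"
    by (simp add: XU)
  also have "\<dots> = (\<integral>\<^sup>+x. emeasure (distr M borel U) (Pair x -` ?A) \<partial>distr M N X)"
    by (intro U.emeasure_pair_measure_alt) simp
  also have "\<dots> = (\<integral>\<^sup>+x. ennreal (b x) \<partial>distr M N X)"
  proof (intro nn_integral_cong)
    fix x assume "x \<in> space (distr M N X)"
    then have "Pair x -` ?A = {..b x}"
      by (auto simp: space_pair_measure)
    then show "emeasure (distr M borel U) (Pair x -` ?A) = ennreal (b x)"
      unfolding U using emeasure_uniform_le [OF b01] by simp
  qed
  also have "\<dots> = ennreal (\<integral>x. b x \<partial>distr M N X)"
  proof (rule nn_integral_eq_integral)
    show "integrable (distr M N X) b"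
      using b01 by (intro X.integrable_const_bound [where B = 1]) (auto intro!: AE_I2)
  qed (simp add: b01)
  finally show ?thesis
    unfolding emeasure_eq_measure using b01 by (subst (asm) ennreal_inj) simp_all
qed

section \<open>The law of the index\<close>

lemma nn_integral_count_space_enat:
  assumes "f 0 = 0" "f \<infinity> = 0"
  shows "(\<integral>\<^sup>+k. f k \<partial>count_space (UNIV :: enat set)) = (\<Sum>n. f (enat (Suc n)))"
proof -
  \<comment> \<open>Steps are numbered from 1 and a run may never stop, so 0 and \<infinity> are the
    two values outside the range of the reindexing.\<close>
  have "(\<integral>\<^sup>+k. f k \<partial>count_space UNIV) = (\<integral>\<^sup>+k. f k \<partial>count_space (range (\<lambda>n. enat (Suc n))))"
  proof (rule nn_integral_count_space_eq)
    fix k :: enat assume "k \<in> UNIV - range (\<lambda>n. enat (Suc n))"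
    then have "k = 0 \<or> k = \<infinity>"
      by (cases k) (auto simp: zero_enat_def image_iff elim: not0_implies_Suc [elim_format])
    with assms show "f k = 0" by auto
  qed auto
  also have "\<dots> = (\<integral>\<^sup>+n. f (enat (Suc n)) \<partial>count_space UNIV)"
    by (rule nn_integral_bij_count_space [symmetric]) (auto simp: bij_betw_def inj_on_def)
  finally show ?thesis
    by (simp add: nn_integral_count_space_nat)
qed

text \<open>A lower bound on an infimum is a condition on each member, so survival events are plain
  conjunctions over rounds. This also covers a run that never stops, where the infimum is over the
  empty set.\<close>

lemma enat_Suc_le_grs_index_iff:
  "enat (Suc n) \<le> grs_index P Q r X U \<omega> \<longleftrightarrow> (\<forall>j\<in>{1..n}. \<not> U j \<omega> \<le> grs_beta P Q r j (X j \<omega>))"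
proof -
  have "enat (Suc n) \<le> grs_index P Q r X U \<omega>
      \<longleftrightarrow> (\<forall>j. 1 \<le> j \<and> U j \<omega> \<le> grs_beta P Q r j (X j \<omega>) \<longrightarrow> \<not> j \<le> n)"
    by (simp add: grs_index_def le_INF_iff Suc_le_eq not_le)
  then show ?thesis by auto
qed

context greedy_rejection
begin

text \<open>By independence the survival probability is a product of rejection probabilities. By
  \<open>integral_grs_beta\<close> the factor of round \<open>Suc n\<close> turns
  \<open>S (n+1)\<close> into \<open>S (n+2)\<close>, with no division by \<open>S\<close>.\<close>

lemma prob_grs_index_ge:
  fixes M :: "'w measure" and X :: "nat \<Rightarrow> 'w \<Rightarrow> 'a" and U :: "nat \<Rightarrow> 'w \<Rightarrow> real"
  assumes M: "prob_space M"
    and pair: "prob_space.indep_vars M (\<lambda>_. P \<Otimes>\<^sub>M borel) (\<lambda>k \<omega>. (X k \<omega>, U k \<omega>)) {1..}"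
    and accept: "\<And>k. 1 \<le> k \<Longrightarrow> measure M {\<omega> \<in> space M. U k \<omega> \<le> grs_beta P Q r k (X k \<omega>)}
      = (\<integral>x. grs_beta P Q r k x \<partial>P)"
  shows "measure M {\<omega> \<in> space M. enat (Suc n) \<le> grs_index P Q r X U \<omega>} = grs_S P Q r (Suc n)"
    and "{\<omega> \<in> space M. enat (Suc n) \<le> grs_index P Q r X U \<omega>} \<in> sets M"
proof -
  interpret M: prob_space M by fact
  let ?R = "\<lambda>j. {z \<in> space (P \<Otimes>\<^sub>M borel). \<not> snd z \<le> grs_beta P Q r j (fst z)}"
  let ?XU = "\<lambda>j \<omega>. (X j \<omega>, U j \<omega>)"
  let ?E = "\<lambda>j. ?XU j -` ?R j \<inter> space M"
  have XU [measurable]: "?XU j \<in> measurable M (P \<Otimes>\<^sub>M borel)" if "j \<in> {1..}" for j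
    using pair that unfolding M.indep_vars_def by auto
  have E_eq: "?E j = space M - {\<omega> \<in> space M. U j \<omega> \<le> grs_beta P Q r j (X j \<omega>)}" if "1 \<le> j" for j
    using measurable_space [OF XU [of j]] that by auto
  have E: "?E j \<in> sets M" if "1 \<le> j" for j
    using that by (intro measurable_sets [OF XU]) auto
  \<comment> \<open>Intersecting with \<open>space M\<close> matters for \<open>n = 0\<close>, where
    the intersection over no rounds is \<open>UNIV\<close>.\<close>
  have surv: "{\<omega> \<in> space M. enat (Suc n) \<le> grs_index P Q r X U \<omega>} = (\<Inter>j\<in>{1..n}. ?E j) \<inter> space M" for n
    using E_eq by (auto simp: enat_Suc_le_grs_index_iff)
  show "{\<omega> \<in> space M. enat (Suc n) \<le> grs_index P Q r X U \<omega>} \<in> sets M"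
    unfolding surv using E by (cases "n = 0") auto
  have pE: "measure M (?E j) = 1 - (\<integral>x. grs_beta P Q r j x \<partial>P)" if "1 \<le> j" for j
  proof -
    have "space M - ?E j = {\<omega> \<in> space M. U j \<omega> \<le> grs_beta P Q r j (X j \<omega>)}"
      using E_eq that by auto
    then show ?thesis
      using M.prob_compl [OF E [OF that]] accept [OF that] by simp
  qed
  have "measure M ((\<Inter>j\<in>{1..n}. ?E j) \<inter> space M) = (\<Prod>j\<in>{1..n}. measure M (?E j))"
  proof (cases "n = 0")
    case False
    then have "(\<Inter>j\<in>{1..n}. ?E j) \<inter> space M = (\<Inter>j\<in>{1..n}. ?E j)"
      by auto
    then show ?thesis
      using False M.indep_varsD [OF pair, of "{1..n}" ?R] by (auto simp: not_less_eq_eq)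
  qed (simp add: M.prob_space)
  also have "\<dots> = grs_S P Q r (Suc n)"
  proof (induction n)
    case (Suc n)
    have "(\<Prod>j\<in>{1..Suc n}. measure M (?E j)) = (\<Prod>j\<in>{1..n}. measure M (?E j)) * measure M (?E (Suc n))"
      by simp
    also have "\<dots> = grs_S P Q r (Suc n) * (1 - (\<integral>x. grs_beta P Q r (Suc n) x \<partial>P))"
      by (simp only: Suc.IH pE [of "Suc n"])
    also have "\<dots> = grs_S P Q r (Suc (Suc n))"
      using integral_grs_beta [of n] by (simp del: grs_S.simps(3) add: algebra_simps)
    finally show ?case .
  qed simp
  finally show "measure M {\<omega> \<in> space M. enat (Suc n) \<le> grs_index P Q r X U \<omega>} = grs_S P Q r (Suc n)"
    by (simp only: surv)
qed

end

section \<open>From the law of the index to its entropy in bits\<close>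

theorem theoremV2:
  fixes P Q :: "'a :: polish_space measure"
    and r :: "'a \<Rightarrow> real"
    and M :: "'w measure"
    and X :: "nat \<Rightarrow> 'w \<Rightarrow> 'a"
    and U :: "nat \<Rightarrow> 'w \<Rightarrow> real"
  assumes "prob_space P" and "sets P = sets borel"
    and "prob_space Q" and "sets Q = sets borel"
    and "absolutely_continuous P Q"
    and "RN_version P Q r"
    and "prob_space M"
    and "prob_space.indep_vars M (\<lambda>_. borel) X {1..}"
    and "\<And>k. 1 \<le> k \<Longrightarrow> distr M borel (X k) = P"
    and "prob_space.indep_vars M (\<lambda>_. borel) U {1..}"
    and "\<And>k. 1 \<le> k \<Longrightarrow> distr M borel (U k) = uniform_measure lborel {0<..<1}"
    and "prob_space.indep_set M
           (sets (vimage_algebra (space M) (\<lambda>\<omega>. \<lambda>k\<in>{1..}. X k \<omega>) (PiM {1..} (\<lambda>_. borel))))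
           (sets (vimage_algebra (space M) (\<lambda>\<omega>. \<lambda>k\<in>{1..}. U k \<omega>) (PiM {1..} (\<lambda>_. borel))))"
  shows "shannon_entropy M (grs_index P Q r X U) \<le> D_CS Q P + ennreal (log 2 (exp 1 + 1))"
proof -
  interpret P: prob_space P by fact
  interpret Q: prob_space Q by fact
  interpret M: prob_space M by fact
  note sets_P [measurable_cong] = \<open>sets P = sets borel\<close>
  have sets_QP: "sets Q = sets P"
    using assms by simp
  have r: "r \<in> borel_measurable P" "AE x in P. r x = enn2real (RN_deriv P Q x)"
    using \<open>RN_version P Q r\<close> by (auto simp: RN_version_def)
  \<comment> \<open>Finiteness makes \<open>enn2real\<close> reversible here, since it sends
    \<infinity> to 0.\<close>
  have "AE x in P. RN_deriv P Q x \<noteq> \<infinity>"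
    using assms sets_QP by (intro P.RN_deriv_finite Q.sigma_finite_measure_axioms) auto
  with r(2) have AE_r: "AE x in P. RN_deriv P Q x = ennreal (r x)"
    by eventually_elim (simp add: less_top)
  have "Q = density P (RN_deriv P Q)"
    using P.density_RN_deriv assms sets_QP by simp
  also have "\<dots> = density P (\<lambda>x. ennreal (r x))"
    using AE_r r(1) by (intro density_cong) auto
  finally have Q: "Q = density P (\<lambda>x. ennreal (r x))" .
  interpret greedy_rejection P Q r
    using r Q \<open>prob_space Q\<close> by unfold_locales auto
  have RN_tail: "RN_tail P Q h = tail h" if "0 \<le> h" for h
    unfolding RN_tail_def tail_def
    using AE_r AE_r_nonneg r(1) by (intro P.finite_measure_eq_AE) (auto simp: that)

  have X: "\<And>k. k \<in> {1..} \<Longrightarrow> X k \<in> borel_measurable M"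
    and U: "\<And>k. k \<in> {1..} \<Longrightarrow> U k \<in> borel_measurable M"
    using assms(8,10) by (auto simp: M.indep_vars_def)
  have pair: "M.indep_vars (\<lambda>_. P \<Otimes>\<^sub>M borel) (\<lambda>k \<omega>. (X k \<omega>, U k \<omega>)) {1..}"
  proof -
    \<comment> \<open>Measurability and independence depend on the target only through its
      sigma-algebra, so \<open>borel\<close> can be exchanged for \<open>P\<close>.\<close>
    have eq: "sets (P \<Otimes>\<^sub>M borel) = sets (borel \<Otimes>\<^sub>M (borel :: real measure))"
      using sets_P by (intro sets_pair_measure_cong) auto
    show ?thesis
      using M.indep_vars_Pair [OF assms(8,10,12)]
      unfolding M.indep_vars_def2 measurable_cong_sets [OF refl eq] eq .
  qed
  have accept: "M.prob {\<omega> \<in> space M. U k \<omega> \<le> grs_beta P Q r k (X k \<omega>)} = (\<integral>x. grs_beta P Q r k x \<partial>P)"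
    if k: "1 \<le> k" for k
  proof -
    have "M.prob {\<omega> \<in> space M. U k \<omega> \<le> grs_beta P Q r k (X k \<omega>)}
        = (\<integral>x. grs_beta P Q r k x \<partial>distr M borel (X k))"
      using k X U grs_beta_bounds assms(11) M.distr_Pair_of_indep_set_vimage_algebra [OF assms(12) X U]
      by (intro M.prob_uniform_le) auto
    then show ?thesis
      using k assms(9) by simp
  qed

  define K where "K = grs_index P Q r X U"
  define p where "p k = M.prob {\<omega> \<in> space M. K \<omega> = k}" for k
  let ?S = "\<lambda>n. grs_S P Q r (Suc n)"
  let ?G = "\<lambda>n. {\<omega> \<in> space M. enat (Suc n) \<le> K \<omega>}"
  have G: "M.prob (?G n) = ?S n" "?G n \<in> sets M" for n
    unfolding K_def by (rule prob_grs_index_ge [OF \<open>prob_space M\<close> pair accept]; assumption)+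
  have K_pos: "enat (Suc 0) \<le> K \<omega>" for \<omega>
    by (simp only: K_def enat_Suc_le_grs_index_iff) simp
  have p_Suc: "p (enat (Suc n)) = ?S n - ?S (Suc n)" for n
  proof -
    have "{\<omega> \<in> space M. K \<omega> = enat (Suc n)} = ?G n - ?G (Suc n)"
    proof -
      have "K \<omega> = enat (Suc n) \<longleftrightarrow> enat (Suc n) \<le> K \<omega> \<and> \<not> enat (Suc (Suc n)) \<le> K \<omega>" for \<omega>
        by (cases "K \<omega>") auto
      then show ?thesis by auto
    qed
    moreover have "M.prob (?G n - ?G (Suc n)) = M.prob (?G n) - M.prob (?G (Suc n))"
      using G(2) by (intro M.finite_measure_Diff) (auto intro: order_trans [rotated])
    ultimately show ?thesis
      by (simp only: p_def G(1))
  qed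
  have "p 0 = 0"
  proof -
    have "K \<omega> \<noteq> 0" for \<omega>
      using K_pos [of \<omega>] by (auto simp: zero_enat_def)
    then show ?thesis by (simp add: p_def)
  qed
  \<comment> \<open>Almost sure termination: a run that never stops survives every round, and the
    survival probabilities tend to 0.\<close>
  moreover have "p \<infinity> = 0"
  proof -
    have "p \<infinity> \<le> ?S n" for n
      unfolding p_def G(1) [symmetric] by (intro M.finite_measure_mono G(2)) auto
    then have "p \<infinity> \<le> 0"
      by (intro LIMSEQ_le_const [OF grs_S_tendsto_0] exI allI impI)
    then show ?thesis
      by (simp add: p_def measure_le_0_iff)
  qed
  ultimately have "shannon_entropy M K = (\<Sum>n. ennreal (- (p (enat (Suc n)) * log 2 (p (enat (Suc n))))))"
    unfolding shannon_entropy_def Let_def p_def [symmetric]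
    by (intro nn_integral_count_space_enat) auto
  \<comment> \<open>The factor \<open>1 / ln 2\<close> converts nats to bits; below it turns the
    integral into \<open>D_CS Q P\<close> and the constant into
    \<open>log 2 (exp 1 + 1)\<close>.\<close>
  also have "\<dots> = (\<Sum>n. ennreal (1 / ln 2) * ennreal (plogp (?S n - ?S (Suc n))))"
    by (simp del: grs_S.simps add: p_Suc plogp_def log_def ennreal_mult' [symmetric])
  also have "\<dots> = ennreal (1 / ln 2) * (\<Sum>n. ennreal (plogp (?S n - ?S (Suc n))))"
    by simp
  also have "\<dots> \<le> ennreal (1 / ln 2) *
      ((\<integral>\<^sup>+h\<in>{0..}. ennreal (plogp (tail h)) \<partial>lborel) + ennreal (ln (exp 1 + 1)))"
    by (intro mult_left_mono suminf_plogp_le) auto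
  also have "\<dots> = ennreal (1 / ln 2) * (\<integral>\<^sup>+h\<in>{0..}. ennreal (plogp (tail h)) \<partial>lborel)
      + ennreal (log 2 (exp 1 + 1))"
    by (simp add: distrib_left log_def ennreal_mult' [symmetric])
  also have "ennreal (1 / ln 2) * (\<integral>\<^sup>+h\<in>{0..}. ennreal (plogp (tail h)) \<partial>lborel)
      = (\<integral>\<^sup>+h. ennreal (1 / ln 2) * (ennreal (plogp (tail h)) * indicator {0..} h) \<partial>lborel)"
    by (intro nn_integral_cmult [symmetric]) simp
  also have "\<dots> = D_CS Q P"
    unfolding D_CS_def
    by (intro nn_integral_cong)
      (auto simp: indicator_def RN_tail plogp_def log_def ennreal_mult' [symmetric])
  finally show ?thesis
    by (simp add: K_def)
qed

end
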